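(* For every integer $d\ge 1$ let $O_d$ denote the number of finite $O$-sequences of multiplicity $d$. Then the sequence $(O_d)_{d\ge 1}$ is sub-Fibonacci.
   Context: Let $K$ be a field. For a homogeneous ideal $I$ of a standard graded polynomial ring $R=K[x_1,\dots,x_p]$, the Hilbert function of $R/I$ is $t\mapsto \dim_K R_t-\dim_K I_t$. An $O$-sequence is a numerical function $(a_0,a_1,\dots)$ that is the Hilbert function of some such $R/I$. A finite $O$-sequence is an $O$-sequence which is eventually zero (i.e. the Hilbert function of an Artinian quotient $R/I$), written $(a_0,a_1,\dots,a_s)$ with $a_s\neq 0$; its multiplicity is $\sum_{i=0}^s a_i$. Equivalently (Macaulay), a finite sequence of positive integers $(a_0,\dots,a_s)$ is a finite $O$-sequence if and only if $a_0=1$ and $a_{t+1}\le a_t^{\langle t\rangle}$ for all $1\le t<s$. Here, for positive integers $a,t$ with binomial expansion $a=\binom{k(t)}{t}+\binom{k(t-1)}{t-1}+\dots+\binom{k(j)}{j}$, $k(t)>k(t-1)>\dots>k(j)\ge j\ge 1$ (such an expansion exists and is unique), one sets $a^{\langle t\rangle}=\binom{k(t)+1}{t+1}+\binom{k(t-1)+1}{t}+\dots+\binom{k(j)+1}{j+1}$. A non-decreasing integer sequence $(x_k)_{k\ge 1}$ with $x_1=x_2=1$ is called sub-Fibonacci if $x_k\le x_{k-1}+x_{k-2}$ for all $k\ge 3$. *)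

theory Defs
  imports Complex_Main "HOL-Library.Poly_Mapping"
begin

text \<open>
  Polynomials in the variables \<open>x\<^sub>0, x\<^sub>1, \<dots>\<close> over a field: finitely supported functions from
  exponent vectors to coefficients.  The ring \<open>K[x\<^sub>1,\<dots>,x\<^sub>p]\<close> is the subring of those
  polynomials that involve only the variables with index below \<open>p\<close>, so that the number of
  variables can be quantified over.
\<close>

type_synonym 'k multipoly = "(nat \<Rightarrow>\<^sub>0 nat) \<Rightarrow>\<^sub>0 'k"

definition poly_scale :: "'k::field \<Rightarrow> 'k multipoly \<Rightarrow> 'k multipoly" where
  "poly_scale c f = Poly_Mapping.single 0 c * f"

interpretation poly_vs: vector_space poly_scale
  by unfold_locales
    (simp_all add: poly_scale_def algebra_simps single_add mult_single flip: mult.assoc)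

definition poly_ring :: "nat \<Rightarrow> 'k::field multipoly set" where
  "poly_ring p = {f. \<forall>m\<in>Poly_Mapping.keys f. Poly_Mapping.keys m \<subseteq> {..<p}}"

definition monom_degree :: "(nat \<Rightarrow>\<^sub>0 nat) \<Rightarrow> nat" where
  "monom_degree m = (\<Sum>i\<in>Poly_Mapping.keys m. Poly_Mapping.lookup m i)"

definition homogeneous_part :: "nat \<Rightarrow> nat \<Rightarrow> 'k::field multipoly set" where
  "homogeneous_part p t =
     {f \<in> poly_ring p. \<forall>m\<in>Poly_Mapping.keys f. monom_degree m = t}"

definition homogeneous_component :: "nat \<Rightarrow> 'k::field multipoly \<Rightarrow> 'k multipoly" where
  "homogeneous_component t f =
     (\<Sum>m | m \<in> Poly_Mapping.keys f \<and> monom_degree m = t.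
        Poly_Mapping.single m (Poly_Mapping.lookup f m))"

definition homogeneous_ideal :: "nat \<Rightarrow> 'k::field multipoly set \<Rightarrow> bool" where
  "homogeneous_ideal p I \<longleftrightarrow>
     I \<subseteq> poly_ring p \<and> 0 \<in> I \<and>
     (\<forall>f\<in>I. \<forall>g\<in>I. f + g \<in> I) \<and>
     (\<forall>r\<in>poly_ring p. \<forall>f\<in>I. r * f \<in> I) \<and>
     (\<forall>f\<in>I. \<forall>t. homogeneous_component t f \<in> I)"

text \<open>
  The Hilbert function of \<open>R/I\<close>, where \<open>I\<^sub>t = I \<inter> R\<^sub>t\<close>.  The truncated subtraction is
  harmless: \<open>I\<^sub>t\<close> is a subspace of the finite-dimensional space \<open>R\<^sub>t\<close>.
\<close>

definition hilbert_function :: "nat \<Rightarrow> 'k::field multipoly set \<Rightarrow> nat \<Rightarrow> nat" where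
  "hilbert_function p I t =
     poly_vs.dim (homogeneous_part p t :: 'k multipoly set)
       - poly_vs.dim (I \<inter> homogeneous_part p t)"

definition O_sequence :: "'k::field itself \<Rightarrow> (nat \<Rightarrow> nat) \<Rightarrow> bool" where
  "O_sequence K a \<longleftrightarrow>
     (\<exists>p (I :: 'k multipoly set). homogeneous_ideal p I \<and> a = hilbert_function p I)"

definition finite_O_sequence :: "'k::field itself \<Rightarrow> (nat \<Rightarrow> nat) \<Rightarrow> bool" where
  "finite_O_sequence K a \<longleftrightarrow> O_sequence K a \<and> eventually (\<lambda>t. a t = 0) sequentially"

definition multiplicity_seq :: "(nat \<Rightarrow> nat) \<Rightarrow> nat" where
  "multiplicity_seq a = (\<Sum>i | a i \<noteq> 0. a i)"

definition num_O_sequences :: "'k::field itself \<Rightarrow> nat \<Rightarrow> nat" where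
  "num_O_sequences K d = card {a. finite_O_sequence K a \<and> multiplicity_seq a = d}"

text \<open>Only the values of the sequence at indices \<open>k \<ge> 1\<close> matter.\<close>

definition sub_Fibonacci :: "(nat \<Rightarrow> int) \<Rightarrow> bool" where
  "sub_Fibonacci x \<longleftrightarrow>
     mono_on {1..} x \<and> x 1 = 1 \<and> x 2 = 1 \<and> (\<forall>k\<ge>3. x k \<le> x (k - 1) + x (k - 2))"

end

theory Submission
  imports Defs
begin

text \<open>
  Passing to leading monomials, the finite \<open>O\<close>-sequences of multiplicity \<open>d\<close> are the sequences of
  degree counts of the order ideals of monomials with \<open>d\<close> elements, over any field.  Adjoining a new
  variable raises \<open>a\<^sub>1\<close> by one, which gives monotonicity.  Compressing an order ideal towards the
  variable \<open>x\<^sub>0\<close> makes it contain a pure power of the top degree, so that a sequence may always be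
  extended by a final \<open>1\<close>.

  For the Fibonacci inequality one imitates the proof of \<open>p(d) \<le> p(d - 1) + p(d - 2)\<close> for
  partitions.  The sequences of multiplicity \<open>d\<close> ending in \<open>1\<close> come from multiplicity \<open>d - 1\<close> by
  appending \<open>1\<close>.  In a sequence ending in \<open>k \<ge> 2\<close> one replaces that entry by \<open>k - 2\<close> ones; this loses
  nothing, because all earlier entries except \<open>a\<^sub>0\<close> are at least \<open>2\<close>.
\<close>

section \<open>Leading monomials and dimensions\<close>

text \<open>Leading monomials refer to the linear order on exponent vectors, which is compatible
  with addition. For \<open>f = 0\<close> the maximum of the empty set carries no meaning, so
  \<open>0\<close> is excluded wherever leading monomials are collected.\<close>

abbreviation lead :: "'k::zero multipoly \<Rightarrow> (nat \<Rightarrow>\<^sub>0 nat)" where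
  "lead f \<equiv> Max (Poly_Mapping.keys f)"

lemma lookup_single_mult:
  fixes f :: "'a::cancel_comm_monoid_add \<Rightarrow>\<^sub>0 'b::semiring_0"
  shows "Poly_Mapping.lookup (Poly_Mapping.single e c * f) (e + m) = c * Poly_Mapping.lookup f m"
proof -
  let ?g = "\<lambda>l. Sum_any (\<lambda>q. Poly_Mapping.lookup f q when e + m = l + q)"
  have "Sum_any (\<lambda>l. Poly_Mapping.lookup (Poly_Mapping.single e c) l * ?g l)
      = Sum_any (\<lambda>l. c * ?g l when l = e)"
    by (rule Sum_any.cong) (auto simp: lookup_single when_def)
  also have "\<dots> = c * Sum_any (\<lambda>q. Poly_Mapping.lookup f q when m = q)"
    by simp
  also have "\<dots> = c * Poly_Mapping.lookup f m"
    by simp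
  finally show ?thesis
    by (simp add: lookup_mult)
qed

lemma keys_single_mult:
  fixes f :: "'a::cancel_comm_monoid_add \<Rightarrow>\<^sub>0 'b::{semiring_no_zero_divisors}"
  assumes "c \<noteq> 0"
  shows "Poly_Mapping.keys (Poly_Mapping.single e c * f) = (+) e ` Poly_Mapping.keys f"
proof
  show "Poly_Mapping.keys (Poly_Mapping.single e c * f) \<subseteq> (+) e ` Poly_Mapping.keys f"
    using keys_mult[of "Poly_Mapping.single e c" f] by (auto split: if_splits)
  show "(+) e ` Poly_Mapping.keys f \<subseteq> Poly_Mapping.keys (Poly_Mapping.single e c * f)"
    using assms by (auto simp: in_keys_iff lookup_single_mult)
qed

lemma lookup_poly_scale [simp]:
  "Poly_Mapping.lookup (poly_scale c f) m = c * Poly_Mapping.lookup f m"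
  using lookup_single_mult[of 0 c f m] by (simp add: poly_scale_def)

lemma keys_eq_empty [simp]: "Poly_Mapping.keys f = {} \<longleftrightarrow> f = 0"
  by (metis keys_zero not_in_keys_iff_lookup_eq_zero empty_iff poly_mapping_eqI lookup_zero)

lemma lead_in_keys: "f \<noteq> 0 \<Longrightarrow> lead f \<in> Poly_Mapping.keys f"
  by (simp add: Max_in)

lemma lookup_gt_lead: "lead f < m \<Longrightarrow> Poly_Mapping.lookup f m = 0"
  by (metis Max_ge finite_keys in_keys_iff leD)

lemma lookup_lead: "f \<noteq> 0 \<Longrightarrow> Poly_Mapping.lookup f (lead f) \<noteq> 0"
  using lead_in_keys in_keys_iff by blast

lemma lead_single_mult:
  fixes f :: "'k::field multipoly"
  assumes "f \<noteq> 0" "c \<noteq> 0"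
  shows "lead (Poly_Mapping.single e c * f) = e + lead f"
proof -
  have "Max ((+) e ` Poly_Mapping.keys f) = e + lead f"
    using assms by (intro Max_eqI) (auto intro: add_left_mono Max_in)
  with assms show ?thesis
    by (simp add: keys_single_mult)
qed

text \<open>In a vanishing combination, take the vector with the largest leading monomial among
  those with nonzero coefficient: no other vector can cancel its leading term.\<close>

lemma independent_if_inj_on_lead:
  fixes B :: "'k::field multipoly set"
  assumes "finite B" "0 \<notin> B" "inj_on lead B"
  shows "poly_vs.independent B"
proof
  assume "poly_vs.dependent B"
  then obtain u where u: "\<exists>v\<in>B. u v \<noteq> 0" "(\<Sum>v\<in>B. poly_scale (u v) v) = 0"
    using assms(1) by (auto simp: poly_vs.dependent_finite)
  define C where "C = {v\<in>B. u v \<noteq> 0}"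
  have C: "finite C" "C \<noteq> {}" "C \<subseteq> B"
    using assms(1) u(1) by (auto simp: C_def)
  then have "Max (lead ` C) \<in> lead ` C" by simp
  then obtain w where w: "w \<in> C" "lead w = Max (lead ` C)" by auto
  have other: "u v * Poly_Mapping.lookup v (lead w) = 0" if v: "v \<in> B" "v \<noteq> w" for v
  proof (cases "u v = 0")
    case False
    then have "v \<in> C" using v by (simp add: C_def)
    then have "lead v \<le> lead w" using w C by simp
    moreover have "lead v \<noteq> lead w"
      using inj_onD[OF assms(3) _ v(1), of w] v w(1) C(3) by auto
    ultimately show ?thesis by (simp add: lookup_gt_lead)
  qed simp
  have "0 = Poly_Mapping.lookup (\<Sum>v\<in>B. poly_scale (u v) v) (lead w)"
    using u by simp
  also have "\<dots> = (\<Sum>v\<in>B. u v * Poly_Mapping.lookup v (lead w))"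
    by (simp add: lookup_sum)
  also have "\<dots> = (\<Sum>v\<in>{w}. u v * Poly_Mapping.lookup v (lead w))"
    using assms(1) w C other by (intro sum.mono_neutral_right) auto
  finally have "u w * Poly_Mapping.lookup w (lead w) = 0" by simp
  moreover have "w \<noteq> 0" using w C assms(2) by auto
  ultimately show False
    using w(1) lookup_lead[of w] by (simp add: C_def)
qed

text \<open>Echelon form: one vector per leading monomial gives an independent family, and reduction
  by leading terms shows that it spans. The finite \<open>T\<close> leaves only finitely many
  leading monomials.\<close>

lemma dim_eq_card_lead:
  fixes V :: "'k::field multipoly set"
  assumes V: "poly_vs.subspace V" and T: "finite T" "\<And>f. f \<in> V \<Longrightarrow> Poly_Mapping.keys f \<subseteq> T"
  shows "poly_vs.dim V = card (lead ` (V - {0}))"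
proof -
  define L where "L = lead ` (V - {0})"
  have "L \<subseteq> T"
    using T(2) lead_in_keys by (fastforce simp: L_def)
  then have "finite L" using T(1) finite_subset by blast
  have "\<forall>m\<in>L. \<exists>f. f \<in> V \<and> f \<noteq> 0 \<and> lead f = m"
    by (auto simp: L_def)
  then obtain g where g: "\<And>m. m \<in> L \<Longrightarrow> g m \<in> V \<and> g m \<noteq> 0 \<and> lead (g m) = m"
    by metis
  have "inj_on lead (g ` L)"
    by (rule inj_onI) (use g in auto)
  moreover have "0 \<notin> g ` L"
    using g by auto
  ultimately have indep: "poly_vs.independent (g ` L)"
    using \<open>finite L\<close> by (intro independent_if_inj_on_lead) auto
  have span: "f \<in> poly_vs.span (g ` L)" if "f \<in> V" for f
  proof (rule ccontr)
    \<comment> \<open>Among the vectors outside the span, one with the least leading monomial is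
      reduced further; the remainder stays outside the span but would have a smaller leading
      monomial.\<close>
    define X where "X = lead ` (V - poly_vs.span (g ` L))"
    assume "f \<notin> poly_vs.span (g ` L)"
    then have "X \<noteq> {}" using that by (auto simp: X_def)
    have "V - poly_vs.span (g ` L) \<subseteq> V - {0}"
      using poly_vs.span_zero by blast
    then have "X \<subseteq> L" by (auto simp: X_def L_def)
    then have "finite X" using \<open>finite L\<close> finite_subset by blast
    then have "Min X \<in> X" using \<open>X \<noteq> {}\<close> by simp
    then obtain h where h: "h \<in> V" "h \<notin> poly_vs.span (g ` L)" "lead h = Min X"
      by (auto simp: X_def)
    have "Min X \<in> L" using \<open>Min X \<in> X\<close> \<open>X \<subseteq> L\<close> by auto
    \<comment> \<open>The factor \<open>c\<close> makes the leading terms of \<open>h\<close> and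
      \<open>poly_scale c (g m)\<close> cancel.\<close>
    define m c q where "m = Min X" and
      "c = Poly_Mapping.lookup h m / Poly_Mapping.lookup (g m) m" and
      "q = h - poly_scale c (g m)"
    have gm: "g m \<in> V" "g m \<noteq> 0" "lead (g m) = m" "g m \<in> poly_vs.span (g ` L)"
      using g \<open>Min X \<in> L\<close> by (auto simp: m_def intro: poly_vs.span_base)
    have "q \<in> V"
      unfolding q_def using V h gm by (intro poly_vs.subspace_diff poly_vs.subspace_scale)
    have "q \<notin> poly_vs.span (g ` L)"
    proof
      assume "q \<in> poly_vs.span (g ` L)"
      then have "q + poly_scale c (g m) \<in> poly_vs.span (g ` L)"
        using gm by (intro poly_vs.span_add poly_vs.span_scale)
      then show False using h by (simp add: q_def)
    qed
    then have "q \<noteq> 0" using poly_vs.span_zero by metis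
    have "lead q \<in> X" using \<open>q \<in> V\<close> \<open>q \<notin> _\<close> by (auto simp: X_def)
    then have "m \<le> lead q" using \<open>finite X\<close> by (simp add: m_def)
    moreover have "Poly_Mapping.lookup q m = 0"
      using lookup_lead[of "g m"] gm by (simp add: q_def c_def lookup_minus)
    moreover have "Poly_Mapping.lookup q n = 0" if "m < n" for n
      using that gm h lookup_gt_lead[of "g m" n] lookup_gt_lead[of h n]
      by (simp add: q_def lookup_minus m_def)
    ultimately show False
      using lookup_lead[OF \<open>q \<noteq> 0\<close>] by (metis order_le_less)
  qed
  have "poly_vs.dim V = card (g ` L)"
    using g span indep by (intro poly_vs.dim_unique[of "g ` L"]) auto
  also have "\<dots> = card L"
    by (rule card_image, rule inj_onI) (use g in metis)
  finally show ?thesis by (simp add: L_def)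
qed

section \<open>Spaces of polynomials with prescribed support\<close>

lemma subspace_supported:
  "poly_vs.subspace {f :: 'k::field multipoly. Poly_Mapping.keys f \<subseteq> S}"
proof (rule poly_vs.subspaceI)
  fix f g :: "'k multipoly" and c :: 'k
  assume *: "f \<in> {f. Poly_Mapping.keys f \<subseteq> S}"
  moreover have "Poly_Mapping.keys (poly_scale c f) \<subseteq> Poly_Mapping.keys f"
    by (auto simp: in_keys_iff)
  ultimately show "poly_scale c f \<in> {f. Poly_Mapping.keys f \<subseteq> S}"
    by blast
  assume "g \<in> {f. Poly_Mapping.keys f \<subseteq> S}"
  with * show "f + g \<in> {f. Poly_Mapping.keys f \<subseteq> S}"
    using keys_add[of f g] by auto
qed auto

lemma dim_supported:
  assumes "finite S"
  shows "poly_vs.dim {f :: 'k::field multipoly. Poly_Mapping.keys f \<subseteq> S} = card S"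
proof -
  have "S \<subseteq> lead ` ({f :: 'k multipoly. Poly_Mapping.keys f \<subseteq> S} - {0})"
  proof
    fix m assume "m \<in> S"
    then show "m \<in> lead ` ({f :: 'k multipoly. Poly_Mapping.keys f \<subseteq> S} - {0})"
      by (intro image_eqI[of _ _ "Poly_Mapping.single m 1"]) (auto simp flip: keys_eq_empty)
  qed
  moreover have "lead ` ({f :: 'k multipoly. Poly_Mapping.keys f \<subseteq> S} - {0}) \<subseteq> S"
    using lead_in_keys by fastforce
  ultimately have eq: "lead ` ({f :: 'k multipoly. Poly_Mapping.keys f \<subseteq> S} - {0}) = S"
    by (rule subset_antisym[rotated])
  show ?thesis
    by (subst dim_eq_card_lead[OF subspace_supported assms], simp, subst eq, rule refl)
qed

section \<open>Monomials and their degrees\<close>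

lemma monom_degree_eq_sum:
  assumes "finite A" "Poly_Mapping.keys m \<subseteq> A"
  shows "monom_degree m = (\<Sum>i\<in>A. Poly_Mapping.lookup m i)"
  unfolding monom_degree_def using assms
  by (intro sum.mono_neutral_left) (auto simp: in_keys_iff)

lemma monom_degree_zero [simp]: "monom_degree 0 = 0"
  by (simp add: monom_degree_def)

lemma monom_degree_single [simp]: "monom_degree (Poly_Mapping.single v n) = n"
  by (simp add: monom_degree_def)

lemma monom_degree_add [simp]: "monom_degree (m + n) = monom_degree m + monom_degree n"
proof -
  let ?A = "Poly_Mapping.keys m \<union> Poly_Mapping.keys n"
  have "Poly_Mapping.keys (m + n) \<subseteq> ?A" by (rule keys_add)
  then show ?thesis
    by (simp add: monom_degree_eq_sum[of ?A] lookup_add sum.distrib)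
qed

lemma lookup_le_monom_degree: "Poly_Mapping.lookup m i \<le> monom_degree m"
proof (cases "i \<in> Poly_Mapping.keys m")
  case True
  then show ?thesis unfolding monom_degree_def by (intro member_le_sum) auto
qed (simp add: not_in_keys_iff_lookup_eq_zero)

lemma monom_degree_eq_0_iff [simp]: "monom_degree m = 0 \<longleftrightarrow> m = 0"
  by (metis monom_degree_zero lookup_le_monom_degree le_zero_eq poly_mapping_eqI lookup_zero)

lemma keys_add_nat:
  "Poly_Mapping.keys (m + n) = Poly_Mapping.keys m \<union> Poly_Mapping.keys (n :: nat \<Rightarrow>\<^sub>0 nat)"
  by (auto simp: in_keys_iff lookup_add)

lemma minus_single_add_single:
  fixes m :: "nat \<Rightarrow>\<^sub>0 nat"
  assumes "v \<in> Poly_Mapping.keys m"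
  shows "m - Poly_Mapping.single v 1 + Poly_Mapping.single v 1 = m"
  using assms by (intro poly_mapping_eqI)
    (auto simp: lookup_add lookup_minus lookup_single when_def in_keys_iff)

definition monoms :: "nat \<Rightarrow> nat \<Rightarrow> (nat \<Rightarrow>\<^sub>0 nat) set" where
  "monoms p t = {m. Poly_Mapping.keys m \<subseteq> {..<p} \<and> monom_degree m = t}"

text \<open>A monomial of degree \<open>t\<close> has all its exponents at most
  \<open>t\<close>.\<close>

lemma finite_monoms: "finite (monoms p t)"
proof (rule finite_imageD)
  have "Poly_Mapping.lookup ` monoms p t \<subseteq>
      {f. \<forall>i. (i \<in> {..<p} \<longrightarrow> f i \<in> {..t}) \<and> (i \<notin> {..<p} \<longrightarrow> f i = 0)}"
    using lookup_le_monom_degree by (fastforce simp: monoms_def subset_iff in_keys_iff)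
  then show "finite (Poly_Mapping.lookup ` monoms p t)"
    by (rule finite_subset) (intro finite_set_of_finite_funs, auto)
qed (simp add: inj_on_def)

lemma homogeneous_part_eq:
  "homogeneous_part p t = {f. Poly_Mapping.keys f \<subseteq> monoms p t}"
  by (auto simp: homogeneous_part_def poly_ring_def monoms_def)

section \<open>Hilbert functions and order ideals\<close>

text \<open>Closure under division by a single variable; iteration gives closure under all divisors.
  The empty set qualifies, so nonemptiness has to come from \<open>1 \<le> d\<close>.\<close>

definition order_ideal :: "(nat \<Rightarrow>\<^sub>0 nat) set \<Rightarrow> bool" where
  "order_ideal M \<longleftrightarrow> (\<forall>m v. m + Poly_Mapping.single v 1 \<in> M \<longrightarrow> m \<in> M)"

definition degree_count :: "(nat \<Rightarrow>\<^sub>0 nat) set \<Rightarrow> nat \<Rightarrow> nat" where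
  "degree_count M t = card {m \<in> M. monom_degree m = t}"

definition order_ideal_counts :: "nat \<Rightarrow> (nat \<Rightarrow> nat) set" where
  "order_ideal_counts d = {degree_count M | M. finite M \<and> order_ideal M \<and> card M = d}"

lemma degree_count_eq_0_iff:
  "finite M \<Longrightarrow> degree_count M t = 0 \<longleftrightarrow> (\<forall>m\<in>M. monom_degree m \<noteq> t)"
  by (auto simp: degree_count_def)

lemma multiplicity_degree_count:
  assumes "finite M"
  shows "multiplicity_seq (degree_count M) = card M"
proof -
  have "{t. degree_count M t \<noteq> 0} = monom_degree ` M"
    using assms by (auto simp: degree_count_eq_0_iff)
  then show ?thesis
    using sum.image_gen[OF assms, of "\<lambda>_. 1::nat" monom_degree]
    by (simp add: multiplicity_seq_def degree_count_def)
qed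

lemma homogeneous_ideal_subspace:
  fixes I :: "'k::field multipoly set"
  assumes "homogeneous_ideal p I"
  shows "poly_vs.subspace (I \<inter> homogeneous_part p t)"
proof -
  have "poly_vs.subspace I"
  proof (rule poly_vs.subspaceI)
    fix f :: "'k multipoly" and c :: 'k assume "f \<in> I"
    moreover have "Poly_Mapping.single 0 c \<in> poly_ring p"
      by (simp add: poly_ring_def)
    ultimately show "poly_scale c f \<in> I"
      using assms by (auto simp: homogeneous_ideal_def poly_scale_def)
  qed (use assms in \<open>auto simp: homogeneous_ideal_def\<close>)
  then show ?thesis
    by (simp add: poly_vs.subspace_inter homogeneous_part_eq subspace_supported)
qed

text \<open>The monomials outside the initial ideal. Only homogeneous elements of the degree of
  \<open>m\<close> are consulted, so that each degree can be counted on its own.\<close>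

definition standard_monoms :: "nat \<Rightarrow> 'k::field multipoly set \<Rightarrow> (nat \<Rightarrow>\<^sub>0 nat) set" where
  "standard_monoms p I = {m. Poly_Mapping.keys m \<subseteq> {..<p} \<and>
     m \<notin> lead ` (I \<inter> homogeneous_part p (monom_degree m) - {0})}"

text \<open>Macaulay's argument: in degree \<open>t\<close> the dimension of \<open>I\<close> is its
  number of leading monomials, so the codimension counts the remaining monomials.\<close>

lemma hilbert_function_eq_degree_count:
  assumes "homogeneous_ideal p I"
  shows "hilbert_function p I = degree_count (standard_monoms p I)"
proof
  fix t
  define L where "L = lead ` (I \<inter> homogeneous_part p t - {0})"
  have L: "L \<subseteq> monoms p t"
    using lead_in_keys by (fastforce simp: L_def homogeneous_part_eq)
  have "hilbert_function p I t = card (monoms p t) - card L"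
    unfolding hilbert_function_def L_def
    using dim_eq_card_lead[OF homogeneous_ideal_subspace[OF assms] finite_monoms[of p t]]
    by (simp add: homogeneous_part_eq dim_supported finite_monoms)
  also have "\<dots> = card (monoms p t - L)"
    using L finite_monoms by (metis card_Diff_subset finite_subset)
  also have "monoms p t - L = {m \<in> standard_monoms p I. monom_degree m = t}"
    by (auto simp: standard_monoms_def monoms_def L_def)
  finally show "hilbert_function p I t = degree_count (standard_monoms p I) t"
    by (simp add: degree_count_def)
qed

text \<open>If \<open>m\<close> is the leading monomial of some \<open>f\<close> in
  \<open>I\<close>, then \<open>m\<close> times a variable is that of the product of
  \<open>f\<close> with this variable, which is again in \<open>I\<close>.\<close>

lemma order_ideal_standard_monoms:
  fixes I :: "'k::field multipoly set"
  assumes "homogeneous_ideal p I"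
  shows "order_ideal (standard_monoms p I)"
  unfolding order_ideal_def
proof (intro allI impI)
  fix m v assume "m + Poly_Mapping.single v 1 \<in> standard_monoms p I"
  then have keys: "Poly_Mapping.keys m \<subseteq> {..<p}" "v < p" and
    notin: "m + Poly_Mapping.single v 1 \<notin>
       lead ` (I \<inter> homogeneous_part p (Suc (monom_degree m)) - {0})"
    by (auto simp: standard_monoms_def keys_add_nat)
  have "m \<notin> lead ` (I \<inter> homogeneous_part p (monom_degree m) - {0})"
  proof
    assume "m \<in> lead ` (I \<inter> homogeneous_part p (monom_degree m) - {0})"
    then obtain f where f: "f \<in> I" "f \<noteq> 0" "lead f = m"
        "Poly_Mapping.keys f \<subseteq> monoms p (monom_degree m)"
      by (auto simp: homogeneous_part_eq)
    define x :: "'k multipoly" where "x = Poly_Mapping.single (Poly_Mapping.single v 1) 1"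
    have keys_x: "Poly_Mapping.keys (x * f) = (+) (Poly_Mapping.single v 1) ` Poly_Mapping.keys f"
      unfolding x_def by (rule keys_single_mult) simp
    have "x \<in> poly_ring p"
      using keys(2) by (simp add: x_def poly_ring_def)
    then have "x * f \<in> I"
      using f(1) assms by (auto simp: homogeneous_ideal_def)
    moreover have "x * f \<noteq> 0"
      using keys_x f(2) by (metis image_is_empty keys_eq_empty)
    moreover have "x * f \<in> homogeneous_part p (Suc (monom_degree m))"
    proof -
      have "Poly_Mapping.single v 1 + n \<in> monoms p (Suc (monom_degree m))"
        if "n \<in> Poly_Mapping.keys f" for n
        using that f(4) keys(2) by (auto simp: monoms_def keys_add_nat subset_iff)
      then show ?thesis by (auto simp: homogeneous_part_eq keys_x)
    qed
    moreover have "lead (x * f) = m + Poly_Mapping.single v 1"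
      using lead_single_mult[OF f(2), of 1] f(3) by (simp add: x_def add.commute)
    ultimately show False using notin by (metis Diff_iff Int_iff imageI singletonD)
  qed
  with keys show "m \<in> standard_monoms p I"
    by (simp add: standard_monoms_def)
qed

lemma lookup_homogeneous_component:
  "Poly_Mapping.lookup (homogeneous_component t f) m =
     (if monom_degree m = t then Poly_Mapping.lookup f m else 0)"
  by (auto simp: homogeneous_component_def lookup_sum lookup_single when_def
      not_in_keys_iff_lookup_eq_zero sum.delta in_keys_iff)

text \<open>Multiples of a monomial outside an order ideal stay outside, so the polynomials
  supported there form an ideal. It is homogeneous because membership is decided monomial by
  monomial.\<close>

lemma monomial_ideal_homogeneous:
  fixes M p
  assumes "order_ideal M"
  defines "I \<equiv> {f :: 'k::field multipoly. f \<in> poly_ring p \<and> Poly_Mapping.keys f \<inter> M = {}}"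
  shows "homogeneous_ideal p I"
  unfolding homogeneous_ideal_def
proof (intro conjI ballI allI)
  \<comment> \<open>Closure under one variable extends to every divisor by splitting variables off
    \<open>n\<close> one at a time.\<close>
  have mult: "m \<in> M" if "n + m \<in> M" for m n
    using that
  proof (induction "monom_degree n" arbitrary: n)
    case (Suc k)
    then obtain v where v: "v \<in> Poly_Mapping.keys n"
      by (metis monom_degree_eq_0_iff nat.distinct(1) keys_eq_empty equals0I)
    define n' where "n' = n - Poly_Mapping.single v 1"
    have n: "n = n' + Poly_Mapping.single v 1"
      using minus_single_add_single[OF v] by (simp add: n'_def)
    then have "n' + m + Poly_Mapping.single v 1 \<in> M"
      using Suc.prems by (simp add: ac_simps)
    then have "n' + m \<in> M"
      using assms(1) by (auto simp: order_ideal_def)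
    moreover have "k = monom_degree n'" using Suc.hyps(2) n by simp
    ultimately show ?case using Suc.hyps(1) by blast
  qed simp
  fix f g :: "'k multipoly" assume "f \<in> I"
  then have f: "f \<in> poly_ring p" "Poly_Mapping.keys f \<inter> M = {}" by (auto simp: I_def)
  {
    assume "g \<in> I"
    with f show "f + g \<in> I"
      using keys_add[of f g] unfolding I_def poly_ring_def by blast
  next
    assume "g \<in> poly_ring p"
    have "Poly_Mapping.keys m \<subseteq> {..<p} \<and> m \<notin> M" if m: "m \<in> Poly_Mapping.keys (g * f)" for m
    proof -
      obtain a b where ab: "m = a + b" "a \<in> Poly_Mapping.keys g" "b \<in> Poly_Mapping.keys f"
        using keys_mult[of g f] m by auto
      then have "b \<notin> M" using f by auto
      then have "m \<notin> M" using mult ab(1) by blast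
      then show ?thesis
        using ab f(1) \<open>g \<in> poly_ring p\<close> by (auto simp: poly_ring_def keys_add_nat)
    qed
    then show "g * f \<in> I" by (auto simp: I_def poly_ring_def)
  }
  fix t
  have "Poly_Mapping.keys (homogeneous_component t f) \<subseteq> Poly_Mapping.keys f"
    by (auto simp: in_keys_iff lookup_homogeneous_component split: if_splits)
  with f show "homogeneous_component t f \<in> I"
    by (auto simp: I_def poly_ring_def)
qed (auto simp: I_def poly_ring_def)

lemma degree_count_is_hilbert_function:
  fixes M p
  assumes "order_ideal M" and M: "\<And>m. m \<in> M \<Longrightarrow> Poly_Mapping.keys m \<subseteq> {..<p}"
  defines "I \<equiv> {f :: 'k::field multipoly. f \<in> poly_ring p \<and> Poly_Mapping.keys f \<inter> M = {}}"
  shows "hilbert_function p I = degree_count M"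
proof
  fix t
  have "I \<inter> homogeneous_part p t = {f. Poly_Mapping.keys f \<subseteq> monoms p t - M}"
    by (auto simp: I_def homogeneous_part_eq poly_ring_def monoms_def)
  then have "hilbert_function p I t = card (monoms p t) - card (monoms p t - M)"
    by (simp add: hilbert_function_def homogeneous_part_eq dim_supported finite_monoms)
  also have "\<dots> = card (monoms p t \<inter> M)"
    using card_Int_Diff[of "monoms p t" M] by (simp add: finite_monoms)
  also have "monoms p t \<inter> M = {m \<in> M. monom_degree m = t}"
    using M by (auto simp: monoms_def)
  finally show "hilbert_function p I t = degree_count M t"
    by (simp add: degree_count_def)
qed

lemma finite_standard_monoms:
  assumes "homogeneous_ideal p I" "eventually (\<lambda>t. hilbert_function p I t = 0) sequentially"
  shows "finite (standard_monoms p I)"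
proof -
  obtain N where N: "\<And>t. t \<ge> N \<Longrightarrow> hilbert_function p I t = 0"
    using assms(2) by (auto simp: eventually_sequentially)
  have "m \<in> (\<Union>t<N. monoms p t)" if m: "m \<in> standard_monoms p I" for m
  proof -
    let ?t = "monom_degree m"
    have sub: "{n \<in> standard_monoms p I. monom_degree n = ?t} \<subseteq> monoms p ?t"
      by (auto simp: standard_monoms_def monoms_def)
    then have "finite {n \<in> standard_monoms p I. monom_degree n = ?t}"
      using finite_monoms by (rule finite_subset)
    \<comment> \<open>Finiteness matters here: the cardinality of an infinite set would be
      0.\<close>
    then have "hilbert_function p I ?t \<noteq> 0"
      using m by (auto simp: hilbert_function_eq_degree_count[OF assms(1)] degree_count_def)
    then have "?t < N" by (rule contrapos_np) (simp add: N)
    with m sub show ?thesis by blast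
  qed
  then have "standard_monoms p I \<subseteq> (\<Union>t<N. monoms p t)"
    by (rule subsetI)
  then show ?thesis
    by (rule finite_subset) (simp add: finite_monoms)
qed

text \<open>The count is thus independent of the field: an ideal yields the order ideal of its
  standard monomials, and an order ideal yields a monomial ideal whose Hilbert function is its
  degree count.\<close>

lemma finite_O_sequences_eq_order_ideal_counts:
  "{a. finite_O_sequence TYPE('k::field) a \<and> multiplicity_seq a = d} = order_ideal_counts d"
proof (intro set_eqI iffI)
  fix a assume "a \<in> {a. finite_O_sequence TYPE('k) a \<and> multiplicity_seq a = d}"
  then obtain p and I :: "'k multipoly set" where I: "homogeneous_ideal p I"
      and a: "a = hilbert_function p I" and "eventually (\<lambda>t. a t = 0) sequentially"
      and d: "multiplicity_seq a = d"
    by (auto simp: finite_O_sequence_def O_sequence_def)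
  then have fin: "finite (standard_monoms p I)"
    using finite_standard_monoms by blast
  have a': "a = degree_count (standard_monoms p I)"
    using a hilbert_function_eq_degree_count[OF I] by simp
  then have "card (standard_monoms p I) = d"
    using d multiplicity_degree_count[OF fin] by simp
  then show "a \<in> order_ideal_counts d"
    unfolding order_ideal_counts_def using a' fin order_ideal_standard_monoms[OF I]
    by (intro CollectI exI[of _ "standard_monoms p I"] conjI)
next
  fix a assume "a \<in> order_ideal_counts d"
  then obtain M where M: "finite M" "order_ideal M" "card M = d" "a = degree_count M"
    by (auto simp: order_ideal_counts_def)
  let ?I = "\<lambda>p. {f :: 'k multipoly. f \<in> poly_ring p \<and> Poly_Mapping.keys f \<inter> M = {}}"
  \<comment> \<open>A finite \<open>M\<close> involves finitely many variables, which yields the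
    number \<open>p\<close> of variables of the ring.\<close>
  have "finite (\<Union> (Poly_Mapping.keys ` M))" using M by simp
  then obtain p where p: "\<forall>i\<in>\<Union> (Poly_Mapping.keys ` M). i < p"
    unfolding finite_nat_set_iff_bounded ..
  then have "Poly_Mapping.keys m \<subseteq> {..<p}" if "m \<in> M" for m
    using that by auto
  then have "hilbert_function p (?I p) = a"
    using degree_count_is_hilbert_function[OF M(2), of p] M(4) by simp
  then have "O_sequence TYPE('k) a"
    unfolding O_sequence_def
    by (intro exI[of _ p] exI[of _ "?I p"] conjI monomial_ideal_homogeneous[OF M(2)]) (rule sym)
  moreover have "finite {t. a t \<noteq> 0}"
  proof (rule finite_subset)
    show "{t. a t \<noteq> 0} \<subseteq> monom_degree ` M"
      using M by (auto simp: degree_count_eq_0_iff)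
  qed (use M in simp)
  then have "eventually (\<lambda>t. a t = 0) sequentially"
    unfolding cofinite_eq_sequentially[symmetric] eventually_cofinite .
  ultimately show "a \<in> {a. finite_O_sequence TYPE('k) a \<and> multiplicity_seq a = d}"
    using M multiplicity_degree_count[OF M(1)]
    by (simp add: finite_O_sequence_def)
qed

section \<open>Compression of order ideals\<close>

text \<open>The rank is strictly increasing on \<open>F\<close> and stays below
  \<open>card F\<close>. It later pushes the occupied slots of a fibre down to an initial
  segment.\<close>

lemma bij_betw_rank:
  fixes F :: "nat set"
  assumes "finite F"
  shows "bij_betw (\<lambda>j. card {i\<in>F. i < j}) F {..<card F}"
proof -
  let ?r = "\<lambda>j. card {i\<in>F. i < j}"
  have mono: "?r i < ?r j" if "i \<in> F" "i < j" for i j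
    using assms that by (intro psubset_card_mono) auto
  have "inj_on ?r F"
  proof (rule inj_onI)
    fix i j assume "i \<in> F" "j \<in> F" "?r i = ?r j"
    then show "i = j" using mono[of i j] mono[of j i] by (cases i j rule: linorder_cases) auto
  qed
  moreover have "?r j < card F" if "j \<in> F" for j
    using assms that by (intro psubset_card_mono) auto
  then have "?r ` F \<subseteq> {..<card F}" by auto
  ultimately show ?thesis
    by (simp add: bij_betw_def card_image card_subset_eq)
qed

text \<open>\<open>G\<close> and \<open>H\<close> are the diagonals of degree \<open>k\<close> and \<open>k + 1\<close> of an order ideal in two variables,
  indexed by the second exponent.  A gap in \<open>G\<close> makes two adjacent gaps in \<open>H\<close>.\<close>

lemma card_diagonal_le:
  fixes G H :: "nat set"
  assumes "G \<subset> {..k}" and le: "\<And>j. j \<in> H \<Longrightarrow> j \<le> k \<Longrightarrow> j \<in> G"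
    and Suc: "\<And>j. Suc j \<in> H \<Longrightarrow> j \<in> G"
  shows "card H \<le> card G"
proof -
  obtain q where q: "q \<le> k" "q \<notin> G" using assms(1) by auto
  then have gap: "q \<notin> H" "Suc q \<notin> H" using le Suc by auto
  \<comment> \<open>Closing the double gap at \<open>q\<close> and \<open>Suc q\<close>: entries
    above it move down by one into \<open>G\<close>, those below stay, and no two collide.\<close>
  let ?f = "\<lambda>j. if j \<le> q then j else j - 1"
  have "inj_on ?f H"
  proof (rule inj_onI)
    fix i j assume "i \<in> H" "j \<in> H" "?f i = ?f j"
    moreover have "i \<noteq> q" "j \<noteq> q" "i \<noteq> Suc q" "j \<noteq> Suc q"
      using gap \<open>i \<in> H\<close> \<open>j \<in> H\<close> by auto
    ultimately show "i = j" by (auto split: if_splits)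
  qed
  moreover have "?f ` H \<subseteq> G"
  proof (rule image_subsetI)
    fix j assume "j \<in> H"
    then show "?f j \<in> G" using le[of j] Suc[of "j - 1"] q by (cases j) auto
  qed
  moreover have "finite G" using assms(1) finite_subset by blast
  ultimately show ?thesis by (rule card_inj_on_le)
qed

text \<open>The compression of \<open>M\<close> towards \<open>x\<^sub>u\<close>: consider the monomials with prescribed exponents
  outside \<open>{u, w}\<close> and prescribed total exponent in \<open>x\<^sub>u, x\<^sub>w\<close>.  If \<open>M\<close> contains \<open>c\<close> of them, replace
  these by the ones whose exponent of \<open>x\<^sub>w\<close> is \<open>0, \<dots>, c - 1\<close>.\<close>

definition rebalance :: "nat \<Rightarrow> nat \<Rightarrow> nat \<Rightarrow> (nat \<Rightarrow>\<^sub>0 nat) \<Rightarrow> (nat \<Rightarrow>\<^sub>0 nat)" where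
  "rebalance u w j m = Poly_Mapping.update u (Poly_Mapping.lookup m u + Poly_Mapping.lookup m w - j)
     (Poly_Mapping.update w j m)"

text \<open>The fibre of \<open>m\<close> consists of the monomials reached by rebalancing. The
  bound on \<open>j\<close> keeps the subtraction in \<open>rebalance\<close> from being
  truncated.\<close>

definition slots :: "nat \<Rightarrow> nat \<Rightarrow> (nat \<Rightarrow>\<^sub>0 nat) set \<Rightarrow> (nat \<Rightarrow>\<^sub>0 nat) \<Rightarrow> nat set" where
  "slots u w M m = {j. j \<le> Poly_Mapping.lookup m u + Poly_Mapping.lookup m w \<and> rebalance u w j m \<in> M}"

definition compression :: "nat \<Rightarrow> nat \<Rightarrow> (nat \<Rightarrow>\<^sub>0 nat) set \<Rightarrow> (nat \<Rightarrow>\<^sub>0 nat) set" where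
  "compression u w M = {m. Poly_Mapping.lookup m w < card (slots u w M m)}"

context
  fixes u w :: nat
  assumes uw: "u \<noteq> w"
begin

lemma lookup_rebalance:
  "Poly_Mapping.lookup (rebalance u w j m) i =
     (if i = u then Poly_Mapping.lookup m u + Poly_Mapping.lookup m w - j
      else if i = w then j else Poly_Mapping.lookup m i)"
  by (auto simp: rebalance_def lookup_update)

lemma rebalance_rebalance:
  assumes "j \<le> Poly_Mapping.lookup m u + Poly_Mapping.lookup m w"
  shows "rebalance u w i (rebalance u w j m) = rebalance u w i m"
  using assms uw by (intro poly_mapping_eqI) (simp add: lookup_rebalance)

lemma rebalance_self: "rebalance u w (Poly_Mapping.lookup m w) m = m"
  by (intro poly_mapping_eqI) (simp add: lookup_rebalance)

lemma monom_degree_rebalance: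
  assumes "j \<le> Poly_Mapping.lookup m u + Poly_Mapping.lookup m w"
  shows "monom_degree (rebalance u w j m) = monom_degree m"
proof -
  let ?A = "insert u (insert w (Poly_Mapping.keys m))"
  have "Poly_Mapping.keys (rebalance u w j m) \<subseteq> ?A"
    by (auto simp: in_keys_iff lookup_rebalance split: if_splits)
  then have "monom_degree (rebalance u w j m) =
      (\<Sum>i\<in>insert u (insert w (?A - {u, w})). Poly_Mapping.lookup (rebalance u w j m) i)"
    by (subst monom_degree_eq_sum[of ?A]) (auto intro: sum.cong)
  also have "\<dots> = Poly_Mapping.lookup m u + (Poly_Mapping.lookup m w +
      (\<Sum>i\<in>?A - {u, w}. Poly_Mapping.lookup (rebalance u w j m) i))"
    using uw assms by (simp add: lookup_rebalance)
  also have "(\<Sum>i\<in>?A - {u, w}. Poly_Mapping.lookup (rebalance u w j m) i) =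
      (\<Sum>i\<in>?A - {u, w}. Poly_Mapping.lookup m i)"
    by (intro sum.cong) (auto simp: lookup_rebalance)
  also have "Poly_Mapping.lookup m u + (Poly_Mapping.lookup m w + \<dots>) =
     (\<Sum>i\<in>insert u (insert w (?A - {u, w})). Poly_Mapping.lookup m i)"
    using uw by simp
  also have "\<dots> = monom_degree m"
    by (subst monom_degree_eq_sum[of ?A]) (auto intro: sum.cong)
  finally show ?thesis .
qed

lemma slots_rebalance:
  assumes "j \<le> Poly_Mapping.lookup m u + Poly_Mapping.lookup m w"
  shows "slots u w M (rebalance u w j m) = slots u w M m"
  using assms uw by (simp add: slots_def rebalance_rebalance lookup_rebalance)

lemma slots_subset: "slots u w M m \<subseteq> {..Poly_Mapping.lookup m u + Poly_Mapping.lookup m w}"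
  by (auto simp: slots_def)

lemma finite_slots: "finite (slots u w M m)"
  using slots_subset finite_subset by blast

lemma lookup_in_slots: "m \<in> M \<Longrightarrow> Poly_Mapping.lookup m w \<in> slots u w M m"
  by (simp add: slots_def rebalance_self)

text \<open>Within each fibre the occupied slots are sent to their ranks, which fill an initial
  segment. A fibre lies in a single degree, so degrees are kept.\<close>

lemma bij_betw_compression:
  "\<exists>f. bij_betw f M (compression u w M) \<and> (\<forall>m\<in>M. monom_degree (f m) = monom_degree m)"
proof -
  define r where "r m j = card {i \<in> slots u w M m. i < j}" for m j
  have r: "bij_betw (r m) (slots u w M m) {..<card (slots u w M m)}" for m
    unfolding r_def by (rule bij_betw_rank[OF finite_slots])
  define f where "f m = rebalance u w (r m (Poly_Mapping.lookup m w)) m" for m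
  have bound: "j \<le> Poly_Mapping.lookup m u + Poly_Mapping.lookup m w"
    if "j < card (slots u w M m)" for j m
    using that card_mono[OF _ slots_subset[of M m]] by simp
  have r_less: "r m j < card (slots u w M m)" if "j \<in> slots u w M m" for m j
    using bij_betwE[OF r] that by auto
  have f: "Poly_Mapping.lookup (f m) w = r m (Poly_Mapping.lookup m w)"
      "slots u w M (f m) = slots u w M m"
      "rebalance u w j (f m) = rebalance u w j m"
      "f m \<in> compression u w M" "monom_degree (f m) = monom_degree m"
    if "m \<in> M" for m j
    using bound[OF r_less[OF lookup_in_slots[OF that]]] r_less[OF lookup_in_slots[OF that]] uw
    by (simp_all add: f_def lookup_rebalance slots_rebalance rebalance_rebalance compression_def
        monom_degree_rebalance)
  have "inj_on f M"
  proof (rule inj_onI)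
    fix m n assume mn: "m \<in> M" "n \<in> M" "f m = f n"
    \<comment> \<open>Equal images lie in one fibre, hence share the rank function, which is
      injective on the occupied slots.\<close>
    then have "slots u w M m = slots u w M n" using f(2) by metis
    moreover from this have "r m = r n" by (simp add: r_def fun_eq_iff)
    ultimately have "Poly_Mapping.lookup m w = Poly_Mapping.lookup n w"
      using r[of n] f(1) mn lookup_in_slots[of m] lookup_in_slots[of n]
      by (metis bij_betw_imp_inj_on inj_onD)
    then show "m = n"
      using f(3) mn rebalance_self by metis
  qed
  moreover have "compression u w M \<subseteq> f ` M"
  proof
    fix m assume "m \<in> compression u w M"
    then have "Poly_Mapping.lookup m w \<in> r m ` slots u w M m"
      using r[of m] by (simp add: compression_def bij_betw_def)
    then obtain j where j: "j \<in> slots u w M m" "r m j = Poly_Mapping.lookup m w" by auto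
    define n where "n = rebalance u w j m"
    have "n \<in> M" and jle: "j \<le> Poly_Mapping.lookup m u + Poly_Mapping.lookup m w"
      using j by (auto simp: n_def slots_def)
    have "Poly_Mapping.lookup n w = j" "r n = r m"
      using uw jle by (auto simp: n_def lookup_rebalance r_def slots_rebalance fun_eq_iff)
    then have "f n = rebalance u w (Poly_Mapping.lookup m w) n"
      using j by (simp add: f_def)
    also have "\<dots> = m"
      using jle by (simp add: n_def rebalance_rebalance rebalance_self)
    finally show "m \<in> f ` M" using \<open>n \<in> M\<close> by blast
  qed
  ultimately have "bij_betw f M (compression u w M)"
    using f(4) by (auto simp: bij_betw_def)
  then show ?thesis using f(5) by blast
qed

text \<open>Division by a variable other than \<open>x\<^sub>u\<close>, \<open>x\<^sub>w\<close>
  carries occupied slots to occupied slots. Division by one of these two passes between neighbouring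
  diagonals, where a diagonal with a gap is at least as large as the next one.\<close>

lemma order_ideal_compression:
  assumes "order_ideal M"
  shows "order_ideal (compression u w M)"
  unfolding order_ideal_def
proof (intro allI impI)
  fix m :: "nat \<Rightarrow>\<^sub>0 nat" and v
  let ?e = "\<lambda>i. Poly_Mapping.single i (1::nat)"
  let ?k = "Poly_Mapping.lookup m u + Poly_Mapping.lookup m w"
  define G H where "G = slots u w M m" and "H = slots u w M (m + ?e v)"
  have M: "n \<in> M" if "n + ?e i \<in> M" for n i
    using assms that by (auto simp: order_ideal_def)
  assume "m + ?e v \<in> compression u w M"
  then have less: "Poly_Mapping.lookup (m + ?e v) w < card H"
    by (simp add: compression_def H_def)
  have "Poly_Mapping.lookup m w < card G"
  proof (cases "v = u \<or> v = w")
    case False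
    then have "rebalance u w j (m + ?e v) = rebalance u w j m + ?e v" for j
      by (intro poly_mapping_eqI)
        (auto simp: lookup_rebalance lookup_add lookup_single when_def)
    then have "H \<subseteq> G"
      using M False
      by (auto simp: G_def H_def slots_def lookup_add lookup_single when_def)
    then have "card H \<le> card G"
      unfolding G_def by (intro card_mono finite_slots)
    then show ?thesis using less False by (simp add: lookup_add lookup_single when_def)
  next
    case True
    \<comment> \<open>Multiplying by \<open>x\<^sub>u\<close> or by \<open>x\<^sub>w\<close> leads
      to the same diagonal, so both values of \<open>v\<close> give the same two relations between
      \<open>H\<close> and \<open>G\<close>.\<close>
    have 1: "rebalance u w j (m + ?e v) = rebalance u w j m + ?e u" if "j \<le> ?k" for j
      using that uw True by (intro poly_mapping_eqI)
        (auto simp: lookup_rebalance lookup_add lookup_single when_def)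
    have 2: "rebalance u w (Suc j) (m + ?e v) = rebalance u w j m + ?e w" for j
      using uw True by (intro poly_mapping_eqI)
        (auto simp: lookup_rebalance lookup_add lookup_single when_def)
    \<comment> \<open>A full diagonal has \<open>?k + 1\<close> slots, more than any exponent of
      \<open>x\<^sub>w\<close> in it; otherwise the comparison of diagonals applies.\<close>
    show ?thesis
    proof (cases "G = {..?k}")
      case False
      then have "G \<subset> {..?k}" using slots_subset by (auto simp: G_def)
      then have "card H \<le> card G"
      proof (rule card_diagonal_le)
        show "j \<in> G" if "j \<in> H" "j \<le> ?k" for j
          using that 1 M by (auto simp: G_def H_def slots_def)
        show "j \<in> G" if "Suc j \<in> H" for j
          using that 2 M uw True
          by (auto simp: G_def H_def slots_def lookup_add lookup_single when_def)
      qed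
      then show ?thesis using less by (simp add: lookup_add)
    qed simp
  qed
  then show "m \<in> compression u w M"
    by (simp add: compression_def G_def)
qed

lemma compression_properties:
  assumes "finite M"
  shows "finite (compression u w M)" "card (compression u w M) = card M"
    "degree_count (compression u w M) = degree_count M"
proof -
  obtain f where f: "bij_betw f M (compression u w M)"
      "\<And>m. m \<in> M \<Longrightarrow> monom_degree (f m) = monom_degree m"
    using bij_betw_compression[of M] by blast
  show "finite (compression u w M)" "card (compression u w M) = card M"
    by (rule iffD1[OF bij_betw_finite[OF f(1)] assms], rule bij_betw_same_card[OF f(1), symmetric])
  show "degree_count (compression u w M) = degree_count M"
  proof
    fix t
    have "compression u w M = f ` M" using f(1) by (simp add: bij_betw_def)
    then have "{m \<in> compression u w M. monom_degree m = t} = f ` {m \<in> M. monom_degree m = t}"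
      using f(2) by auto
    moreover have "inj_on f {m \<in> M. monom_degree m = t}"
      using f(1) by (auto simp: bij_betw_def inj_on_def)
    ultimately show "degree_count (compression u w M) t = degree_count M t"
      unfolding degree_count_def by (simp only: card_image)
  qed
qed

lemma rebalance_0_in_compression:
  assumes "m \<in> M"
  shows "rebalance u w 0 m \<in> compression u w M"
proof -
  have "slots u w M m \<noteq> {}" using lookup_in_slots[OF assms] by auto
  then have "0 < card (slots u w M m)" by (simp add: card_gt_0_iff finite_slots)
  then show ?thesis
    using uw by (simp add: compression_def slots_rebalance lookup_rebalance)
qed

end

text \<open>Compression along a variable \<open>w\<close> of \<open>m\<close> admits the monomial in
  which the whole exponent of \<open>w\<close> has moved to \<open>x\<^sub>0\<close>. Each step
  removes one variable, until a power of \<open>x\<^sub>0\<close> remains.\<close>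

lemma exists_order_ideal_with_pure_power:
  assumes "finite M" "order_ideal M" "m \<in> M"
  shows "\<exists>M'. finite M' \<and> order_ideal M' \<and> card M' = card M \<and> degree_count M' = degree_count M \<and>
    Poly_Mapping.single 0 (monom_degree m) \<in> M'"
  using assms
proof (induction "card (Poly_Mapping.keys m - {0})" arbitrary: M m)
  case 0
  then have keys: "Poly_Mapping.keys m \<subseteq> {0}" by simp
  have "monom_degree m = Poly_Mapping.lookup m 0"
    using monom_degree_eq_sum[OF _ keys] by simp
  then have "m = Poly_Mapping.single 0 (monom_degree m)"
    using keys by (intro poly_mapping_eqI) (auto simp: lookup_single when_def in_keys_iff)
  then show ?case using "0.prems" by (intro exI[of _ M]) simp
next
  case (Suc k)
  then have "Poly_Mapping.keys m - {0} \<noteq> {}" by (metis card.empty nat.distinct(1))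
  then obtain w where w: "w \<in> Poly_Mapping.keys m" "0 \<noteq> w" by auto
  let ?M = "compression 0 w M" and ?m = "rebalance 0 w 0 m"
  have "Poly_Mapping.keys ?m - {0} = Poly_Mapping.keys m - {0} - {w}"
    by (auto simp: in_keys_iff lookup_rebalance[OF w(2)] split: if_splits)
  then have "k = card (Poly_Mapping.keys ?m - {0})"
    using Suc.hyps(2) w by simp
  moreover note compression_properties[OF w(2) Suc.prems(1)]
  moreover note order_ideal_compression[OF w(2) Suc.prems(2)]
    rebalance_0_in_compression[OF w(2) Suc.prems(3)]
  moreover have "monom_degree ?m = monom_degree m"
    by (rule monom_degree_rebalance[OF w(2)]) simp
  ultimately show ?case using Suc.hyps(1)[of ?m ?M] by simp
qed

section \<open>Counting\<close>

lemma order_ideal_countsE: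
  assumes "a \<in> order_ideal_counts d"
  obtains M where "finite M" "order_ideal M" "card M = d" "a = degree_count M"
  using assms by (auto simp: order_ideal_counts_def)

lemma order_ideal_countsI:
  "finite M \<Longrightarrow> order_ideal M \<Longrightarrow> card M = d \<Longrightarrow> degree_count M = a \<Longrightarrow> a \<in> order_ideal_counts d"
  by (auto simp: order_ideal_counts_def)

lemma order_ideal_minus_single:
  assumes "order_ideal M" "m \<in> M" "v \<in> Poly_Mapping.keys m"
  shows "m - Poly_Mapping.single v 1 \<in> M"
  using assms minus_single_add_single[OF assms(3)] by (metis order_ideal_def)

lemma monom_degree_minus_single:
  assumes "v \<in> Poly_Mapping.keys m"
  shows "Suc (monom_degree (m - Poly_Mapping.single v 1)) = monom_degree m"
  using arg_cong[OF minus_single_add_single[OF assms], of monom_degree] by simp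

lemma keys_nonempty_if_monom_degree_pos: "0 < monom_degree m \<Longrightarrow> \<exists>v. v \<in> Poly_Mapping.keys m"
  by (metis equals0I keys_eq_empty monom_degree_zero less_irrefl)

lemma zero_in_order_ideal:
  assumes "order_ideal M" "m \<in> M"
  shows "0 \<in> M"
  using assms(2)
proof (induction "monom_degree m" arbitrary: m)
  case (Suc t)
  then obtain v where "v \<in> Poly_Mapping.keys m"
    using keys_nonempty_if_monom_degree_pos by (metis zero_less_Suc)
  then show ?case
    using Suc order_ideal_minus_single[OF assms(1)] monom_degree_minus_single by (metis nat.inject)
qed simp

lemma order_ideal_counts_0:
  assumes "a \<in> order_ideal_counts d" "1 \<le> d"
  shows "a 0 = 1"
proof -
  obtain M where M: "finite M" "order_ideal M" "card M = d" "a = degree_count M"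
    using assms(1) by (rule order_ideal_countsE)
  then have "M \<noteq> {}" using assms(2) by auto
  then have "0 \<in> M" using zero_in_order_ideal[OF M(2)] by blast
  then have "{m \<in> M. monom_degree m = 0} = {0}" by auto
  then show ?thesis by (simp add: M(4) degree_count_def)
qed

lemma order_ideal_counts_nonzero_Suc:
  assumes "a \<in> order_ideal_counts d" "a (Suc t) \<noteq> 0"
  shows "a t \<noteq> 0"
proof -
  obtain M where M: "finite M" "order_ideal M" "card M = d" "a = degree_count M"
    using assms(1) by (rule order_ideal_countsE)
  then obtain m where m: "m \<in> M" "monom_degree m = Suc t"
    using assms(2) by (auto simp: degree_count_eq_0_iff)
  then obtain v where "v \<in> Poly_Mapping.keys m"
    using keys_nonempty_if_monom_degree_pos by (metis zero_less_Suc)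
  then show ?thesis
    using M m order_ideal_minus_single[OF M(2)] monom_degree_minus_single
    by (metis degree_count_eq_0_iff nat.inject)
qed

text \<open>Let \<open>m0\<close> be the only monomial of degree \<open>t\<close>. A monomial of
  degree \<open>Suc t\<close> becomes \<open>m0\<close> on division by any of its variables, so a
  variable \<open>x\<close> of \<open>m0\<close> divides it and it equals \<open>m0\<close> times
  \<open>x\<close>: there is at most one.\<close>

lemma order_ideal_counts_ge_2_Suc:
  assumes "a \<in> order_ideal_counts d" "2 \<le> a (Suc t)" "1 \<le> t"
  shows "2 \<le> a t"
proof (rule ccontr)
  assume "\<not> 2 \<le> a t"
  obtain M where M: "finite M" "order_ideal M" "card M = d" "a = degree_count M"
    using assms(1) by (rule order_ideal_countsE)
  define D where "D t = {m \<in> M. monom_degree m = t}" for t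
  have D: "finite (D t)" "a t = card (D t)" for t
    using M by (auto simp: D_def degree_count_def)
  have "a t \<noteq> 0" using order_ideal_counts_nonzero_Suc[OF assms(1), of t] assms(2) by simp
  then have "a t = 1" using \<open>\<not> 2 \<le> a t\<close> by linarith
  then have "card (D t) = 1" using D(2) by simp
  then obtain m0 where m0: "D t = {m0}" by (rule card_1_singletonE)
  then have "monom_degree m0 = t" by (auto simp: D_def)
  \<comment> \<open>Here \<open>1 \<le> t\<close> enters; in degree 0 the single monomial has no
    variable, and \<open>a 1\<close> may be large.\<close>
  then obtain x where x: "x \<in> Poly_Mapping.keys m0"
    using assms(3) keys_nonempty_if_monom_degree_pos[of m0] by auto
  have pred: "m - Poly_Mapping.single v 1 = m0" if "m \<in> D (Suc t)" "v \<in> Poly_Mapping.keys m" for m v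
  proof -
    have "m - Poly_Mapping.single v 1 \<in> D t"
      using that order_ideal_minus_single[OF M(2)] monom_degree_minus_single[OF that(2)]
      by (simp add: D_def)
    then show ?thesis using m0 by simp
  qed
  have "m = m0 + Poly_Mapping.single x 1" if m: "m \<in> D (Suc t)" for m
  proof -
    obtain v where v: "v \<in> Poly_Mapping.keys m"
      using m keys_nonempty_if_monom_degree_pos[of m] by (auto simp: D_def)
    have "m = m0 + Poly_Mapping.single v 1"
      using pred[OF m v] minus_single_add_single[OF v] by simp
    then have "x \<in> Poly_Mapping.keys m" using x by (simp add: keys_add_nat)
    then show ?thesis
      using pred[OF m] minus_single_add_single[of x m] by simp
  qed
  then have "D (Suc t) \<subseteq> {m0 + Poly_Mapping.single x 1}" by blast
  then have "card (D (Suc t)) \<le> 1" using card_mono[of "{m0 + Poly_Mapping.single x 1}"] by simp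
  then show False using assms(2) D by simp
qed

lemma order_ideal_counts_ge_2:
  assumes "a \<in> order_ideal_counts d" "2 \<le> a s" "1 \<le> t" "t \<le> s"
  shows "2 \<le> a t"
  using assms(4,2)
  by (induction rule: inc_induct) (use assms order_ideal_counts_ge_2_Suc in auto)

section \<open>Length, support and finiteness\<close>

text \<open>As the support will be an initial segment, this is the first index with value 0; the
  last nonzero entry of a nonzero sequence sits at \<open>count_length a - 1\<close>.\<close>

definition count_length :: "(nat \<Rightarrow> nat) \<Rightarrow> nat" where
  "count_length a = card {t. a t \<noteq> 0}"

lemma count_length_eqI:
  assumes "\<And>t. a t \<noteq> 0 \<longleftrightarrow> t < n"
  shows "count_length a = n"
proof -
  have "{t. a t \<noteq> 0} = {..<n}" using assms by auto
  then show ?thesis by (simp add: count_length_def)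
qed

text \<open>Zeros propagate upwards, so everything from the first zero on vanishes; a zero exists
  because \<open>M\<close> is finite.\<close>

lemma order_ideal_counts_support:
  assumes "a \<in> order_ideal_counts d"
  shows "a t \<noteq> 0 \<longleftrightarrow> t < count_length a" and "(\<Sum>t<count_length a. a t) = d"
proof -
  obtain M where M: "finite M" "order_ideal M" "card M = d" "a = degree_count M"
    using assms by (rule order_ideal_countsE)
  have "{t. a t \<noteq> 0} \<subseteq> monom_degree ` M" using M by (auto simp: degree_count_eq_0_iff)
  then have "finite {t. a t \<noteq> 0}" using M finite_subset by blast
  then obtain t0 where "t0 \<notin> {t. a t \<noteq> 0}" using ex_new_if_finite infinite_UNIV_nat by blast
  then have t0: "a t0 = 0" by simp
  define n where "n = (LEAST t. a t = 0)"
  have "a n = 0" unfolding n_def using t0 by (rule LeastI)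
  have "a t = 0" if "n \<le> t" for t
    using that by (induction rule: dec_induct)
      (use \<open>a n = 0\<close> order_ideal_counts_nonzero_Suc[OF assms] in blast)+
  moreover have "a t \<noteq> 0" if "t < n" for t
    using that not_less_Least by (auto simp: n_def)
  ultimately have supp: "a t \<noteq> 0 \<longleftrightarrow> t < n" for t
    by (metis not_le)
  then have n: "count_length a = n" by (rule count_length_eqI)
  show "a t \<noteq> 0 \<longleftrightarrow> t < count_length a" using supp n by simp
  have "{t. a t \<noteq> 0} = {..<n}" using supp by auto
  then show "(\<Sum>t<count_length a. a t) = d"
    using multiplicity_degree_count[OF M(1)] M n by (simp add: multiplicity_seq_def)
qed

lemma count_length_le:
  assumes "a \<in> order_ideal_counts d"
  shows "count_length a \<le> d"
proof -
  have "(\<Sum>t<count_length a. 1) \<le> (\<Sum>t<count_length a. a t)"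
    using order_ideal_counts_support(1)[OF assms] by (intro sum_mono) (simp add: Suc_le_eq)
  then show ?thesis using order_ideal_counts_support(2)[OF assms] by simp
qed

lemma finite_order_ideal_counts: "finite (order_ideal_counts d)"
proof (rule finite_subset)
  have "a t \<le> d" "t \<ge> d \<Longrightarrow> a t = 0" if a: "a \<in> order_ideal_counts d" for a t
  proof -
    note supp = order_ideal_counts_support[OF a]
    show "t \<ge> d \<Longrightarrow> a t = 0"
      using supp(1)[of t] count_length_le[OF a] by auto
    show "a t \<le> d"
    proof (cases "t < count_length a")
      case True
      then have "a t \<le> (\<Sum>t<count_length a. a t)" by (intro member_le_sum) auto
      then show ?thesis using supp(2) by simp
    qed (use supp(1)[of t] in simp)
  qed
  then show "order_ideal_counts d \<subseteq>
      {a. \<forall>t. (t \<in> {..<d} \<longrightarrow> a t \<in> {..d}) \<and> (t \<notin> {..<d} \<longrightarrow> a t = 0)}"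
    by auto
qed (intro finite_set_of_finite_funs, auto)

section \<open>New sequences from old: a new variable, truncation, appended ones\<close>

lemma order_ideal_insert:
  assumes "order_ideal M" and "\<And>n v. m = n + Poly_Mapping.single v 1 \<Longrightarrow> n \<in> M"
  shows "order_ideal (insert m M)"
  using assms by (auto simp: order_ideal_def)

lemma degree_count_insert:
  assumes "finite M" "m \<notin> M"
  shows "degree_count (insert m M) =
    (degree_count M)(monom_degree m := Suc (degree_count M (monom_degree m)))"
proof
  fix t
  have "{n \<in> insert m M. monom_degree n = t} =
      (if monom_degree m = t then insert m else id) {n \<in> M. monom_degree n = t}"
    by auto
  then show "degree_count (insert m M) t =
      ((degree_count M)(monom_degree m := Suc (degree_count M (monom_degree m)))) t"
    using assms by (simp add: degree_count_def)
qed

text \<open>A variable foreign to \<open>M\<close> can be added at once: dividing it by a variable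
  leaves only the constant monomial, which is in \<open>M\<close>.\<close>

lemma order_ideal_counts_add_variable:
  assumes "a \<in> order_ideal_counts d" "1 \<le> d"
  shows "a(1 := Suc (a 1)) \<in> order_ideal_counts (Suc d)"
proof -
  obtain M where M: "finite M" "order_ideal M" "card M = d" "a = degree_count M"
    using assms(1) by (rule order_ideal_countsE)
  have "finite (\<Union> (Poly_Mapping.keys ` M))" using M by simp
  then obtain v where "v \<notin> \<Union> (Poly_Mapping.keys ` M)"
    using ex_new_if_finite infinite_UNIV_nat by blast
  then have v: "Poly_Mapping.single v 1 \<notin> M" by (force simp: in_keys_iff)
  have "M \<noteq> {}" using M assms(2) by auto
  then have "0 \<in> M" using zero_in_order_ideal[OF M(2)] by blast
  have "n \<in> M" if n: "Poly_Mapping.single v 1 = n + Poly_Mapping.single x 1" for n x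
  proof -
    have "monom_degree n = 0" using arg_cong[OF n, of monom_degree] by simp
    then show ?thesis using \<open>0 \<in> M\<close> by simp
  qed
  then have "order_ideal (insert (Poly_Mapping.single v 1) M)"
    by (rule order_ideal_insert[OF M(2)])
  then show ?thesis
    using M v by (intro order_ideal_countsI[of "insert (Poly_Mapping.single v 1) M"])
      (simp_all add: degree_count_insert)
qed

text \<open>Discarding the monomials of degree at least \<open>n\<close> keeps an order ideal,
  because division lowers the degree.\<close>

lemma order_ideal_counts_truncate:
  assumes "a \<in> order_ideal_counts d"
  shows "(\<lambda>t. if t < n then a t else 0) \<in> order_ideal_counts (\<Sum>t<n. a t)"
proof -
  obtain M where M: "finite M" "order_ideal M" "card M = d" "a = degree_count M"
    using assms by (rule order_ideal_countsE)
  let ?M = "{m \<in> M. monom_degree m < n}"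
  have "order_ideal ?M"
    using M(2) by (auto simp: order_ideal_def)
  moreover have "degree_count ?M = (\<lambda>t. if t < n then a t else 0)"
  proof
    fix t
    have "{m \<in> ?M. monom_degree m = t} = (if t < n then {m \<in> M. monom_degree m = t} else {})"
      by auto
    then show "degree_count ?M t = (if t < n then a t else 0)"
      by (simp add: degree_count_def M(4))
  qed
  moreover have "card ?M = (\<Sum>t<n. a t)"
  proof -
    have "?M = (\<Union>t<n. {m \<in> M. monom_degree m = t})" by auto
    moreover have "card (\<Union>t<n. {m \<in> M. monom_degree m = t}) =
        (\<Sum>t<n. card {m \<in> M. monom_degree m = t})"
      by (intro card_UN_disjoint) (use M(1) in auto)
    ultimately show ?thesis by (simp only: M(4) degree_count_def)
  qed
  ultimately show ?thesis
    using M(1) by (intro order_ideal_countsI[of ?M]) auto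
qed

text \<open>Compression supplies an order ideal with the same counts that contains the power of
  \<open>x\<^sub>0\<close> of top degree. The next power can then be added, as dividing it by a
  variable gives back that power.\<close>

lemma order_ideal_counts_append_1:
  assumes "a \<in> order_ideal_counts d" "1 \<le> d"
  shows "a(count_length a := 1) \<in> order_ideal_counts (Suc d)"
proof -
  note supp = order_ideal_counts_support(1)[OF assms(1)]
  let ?n = "count_length a"
  obtain s where s: "?n = Suc s"
    using supp[of 0] order_ideal_counts_0[OF assms] by (cases ?n) auto
  obtain M where M: "finite M" "order_ideal M" "card M = d" "a = degree_count M"
    using assms(1) by (rule order_ideal_countsE)
  obtain m where m: "m \<in> M" "monom_degree m = s"
    using supp[of s] s M by (auto simp: degree_count_eq_0_iff)
  obtain M' where M': "finite M'" "order_ideal M'" "card M' = d" "a = degree_count M'"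
      "Poly_Mapping.single 0 s \<in> M'"
    using exists_order_ideal_with_pure_power[OF M(1,2) m(1)] M m by metis
  define x :: "nat \<Rightarrow>\<^sub>0 nat" where "x = Poly_Mapping.single 0 ?n"
  have x: "monom_degree x = ?n" by (simp add: x_def)
  \<comment> \<open>The degree of \<open>x\<close> exceeds the top degree by one, so
    \<open>x\<close> is new and the entry at \<open>?n\<close> rises from 0 to 1.\<close>
  have "a ?n = 0" using supp[of ?n] by simp
  then have "x \<notin> M'"
    using M' x by (auto simp: degree_count_eq_0_iff)
  have "y \<in> M'" if y: "x = y + Poly_Mapping.single v 1" for y v
  proof -
    have "v \<in> Poly_Mapping.keys x" using y by (simp add: keys_add_nat)
    then have "v = 0" by (simp add: x_def split: if_splits)
    then have "y + Poly_Mapping.single 0 1 = Poly_Mapping.single 0 (s + 1)"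
      using y s by (simp add: x_def)
    also have "\<dots> = Poly_Mapping.single 0 s + Poly_Mapping.single 0 1"
      by (rule single_add)
    finally show ?thesis using M'(5) by simp
  qed
  then have "order_ideal (insert x M')" by (rule order_ideal_insert[OF M'(2)])
  then show ?thesis
    using M' \<open>x \<notin> M'\<close> x \<open>a ?n = 0\<close>
    by (intro order_ideal_countsI[of "insert x M'"]) (simp_all add: degree_count_insert)
qed

lemma order_ideal_counts_append_ones:
  assumes "a \<in> order_ideal_counts d" "1 \<le> d"
  shows "(\<lambda>t. if t < count_length a then a t else if t < count_length a + j then 1 else 0)
    \<in> order_ideal_counts (d + j)"
proof (induction j)
  case 0
  have "(\<lambda>t. if t < count_length a then a t else if t < count_length a + 0 then 1 else 0) = a"
  proof
    fix t
    show "(if t < count_length a then a t else if t < count_length a + 0 then 1 else 0) = a t"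
      using order_ideal_counts_support(1)[OF assms(1), of t] by auto
  qed
  then show ?case using assms by simp
next
  case (Suc j)
  define b where
    "b j t = (if t < count_length a then a t else if t < count_length a + j then 1 else 0)" for j t
  have "count_length (b j) = count_length a + j"
  proof (rule count_length_eqI)
    fix t show "b j t \<noteq> 0 \<longleftrightarrow> t < count_length a + j"
      using order_ideal_counts_support(1)[OF assms(1), of t] by (simp add: b_def)
  qed
  moreover have "(b j)(count_length a + j := 1) = b (Suc j)"
    by (auto simp: b_def)
  moreover have "b j \<in> order_ideal_counts (d + j)"
    using Suc by (simp add: b_def[abs_def])
  ultimately have "b (Suc j) \<in> order_ideal_counts (Suc (d + j))"
    using order_ideal_counts_append_1[of "b j" "d + j"] assms(2) by simp
  then show ?case by (simp add: b_def[abs_def])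
qed

section \<open>The two inequalities and the initial values\<close>

text \<open>Adjoining a variable changes only the entry at 1, reversibly.\<close>

lemma card_order_ideal_counts_le_Suc:
  assumes "1 \<le> d"
  shows "card (order_ideal_counts d) \<le> card (order_ideal_counts (Suc d))"
proof (rule card_inj_on_le)
  let ?f = "\<lambda>a :: nat \<Rightarrow> nat. a(1 := Suc (a 1))"
  show "inj_on ?f (order_ideal_counts d)"
  proof (rule inj_onI)
    fix a b :: "nat \<Rightarrow> nat" assume eq: "?f a = ?f b"
    show "a = b"
    proof
      fix t show "a t = b t" using fun_cong[OF eq, of t] by (simp split: if_splits)
    qed
  qed
  show "?f ` order_ideal_counts d \<subseteq> order_ideal_counts (Suc d)"
    using order_ideal_counts_add_variable assms by auto
qed (rule finite_order_ideal_counts)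

lemma card_order_ideal_counts_le_add:
  assumes "3 \<le> k"
  shows "card (order_ideal_counts k) \<le>
    card (order_ideal_counts (k - 1)) + card (order_ideal_counts (k - 2))"
proof -
  let ?last = "\<lambda>a. count_length a - 1"
  define P Q where "P = {a \<in> order_ideal_counts k. a (?last a) = 1}" and
    "Q = {a \<in> order_ideal_counts k. 2 \<le> a (?last a)}"
  have last: "0 < count_length a" "a (?last a) \<noteq> 0" "(\<Sum>t<?last a. a t) + a (?last a) = k"
    if "a \<in> order_ideal_counts k" for a
  proof -
    note supp = order_ideal_counts_support[OF that]
    show "0 < count_length a" using supp(2) assms by (cases "count_length a") auto
    then show "a (?last a) \<noteq> 0" using supp(1) by simp
    show "(\<Sum>t<?last a. a t) + a (?last a) = k"
      using supp(2) \<open>0 < count_length a\<close> by (cases "count_length a") auto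
  qed
  have "order_ideal_counts k = P \<union> Q"
    using last(2) by (force simp: P_def Q_def)
  have trunc: "count_length (\<lambda>t. if t < ?last a then a t else 0) = ?last a"
    if "a \<in> order_ideal_counts k" for a
  proof (rule count_length_eqI)
    fix t show "(if t < ?last a then a t else 0) \<noteq> 0 \<longleftrightarrow> t < ?last a"
      using order_ideal_counts_support(1)[OF that, of t] by auto
  qed
  \<comment> \<open>Appending a one to the truncated sequence recovers \<open>a\<close>, so
    \<open>P\<close> is covered by an image of the sequences of multiplicity
    \<open>k - 1\<close>.\<close>
  have "P \<subseteq> (\<lambda>b. b(count_length b := 1)) ` order_ideal_counts (k - 1)"
  proof
    fix a assume "a \<in> P"
    then have a: "a \<in> order_ideal_counts k" "a (?last a) = 1" by (auto simp: P_def)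
    let ?b = "\<lambda>t. if t < ?last a then a t else 0"
    have "(\<Sum>t<?last a. a t) = k - 1" using last(3)[OF a(1)] a(2) by simp
    then have "?b \<in> order_ideal_counts (k - 1)"
      using order_ideal_counts_truncate[OF a(1), of "?last a"] by simp
    moreover have "a = ?b(?last a := 1)"
    proof
      fix t show "a t = (?b(?last a := 1)) t"
        using a(2) order_ideal_counts_support(1)[OF a(1), of t] last(1)[OF a(1)] by auto
    qed
    ultimately show "a \<in> (\<lambda>b. b(count_length b := 1)) ` order_ideal_counts (k - 1)"
      by (intro image_eqI[of _ _ ?b]) (simp_all only: trunc[OF a(1)])
  qed
  then have P: "card P \<le> card (order_ideal_counts (k - 1))"
    by (rule surj_card_le[OF finite_order_ideal_counts])
  \<comment> \<open>The last entry \<open>v\<close> is traded for \<open>v - 2\<close> ones starting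
    at its position, so the total drops by 2; for \<open>v = 2\<close> it is just dropped.\<close>
  define g where "g a t = (if t < ?last a then a t
      else if t < ?last a + (a (?last a) - 2) then 1 else 0)" for a :: "nat \<Rightarrow> nat" and t
  \<comment> \<open>A last entry of at least 2 cannot sit at index 0, where the value is 1.\<close>
  have Q_last: "1 \<le> ?last a" if "a \<in> Q" for a
    using that order_ideal_counts_0[of a k] assms by (cases "?last a") (auto simp: Q_def)
  have "g a \<in> order_ideal_counts (k - 2)" if "a \<in> Q" for a
  proof -
    have a: "a \<in> order_ideal_counts k" "2 \<le> a (?last a)" using that by (auto simp: Q_def)
    let ?b = "\<lambda>t. if t < ?last a then a t else 0"
    let ?d = "\<Sum>t<?last a. a t"
    have b: "?b \<in> order_ideal_counts ?d"
      by (rule order_ideal_counts_truncate[OF a(1)])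
    have "a 0 \<le> ?d" using Q_last[OF that] by (intro member_le_sum) auto
    then have "1 \<le> ?d" using order_ideal_counts_0[OF a(1)] assms by simp
    from order_ideal_counts_append_ones[OF b this, of "a (?last a) - 2"]
    have "g a \<in> order_ideal_counts (?d + (a (?last a) - 2))"
      unfolding trunc[OF a(1)] by (simp add: g_def[abs_def] cong: if_cong)
    moreover have "?d + (a (?last a) - 2) = k - 2" using last(3)[OF a(1)] a(2) by simp
    ultimately show ?thesis by simp
  qed
  moreover have "inj_on g Q"
  proof (rule inj_onI)
    \<comment> \<open>The images reveal the cut point: if \<open>b\<close> were longer,
      \<open>g b\<close> would still show an original entry of at least 2 where \<open>g a\<close>
      is already at most 1.\<close>
    have not_less: "\<not> ?last a < ?last b" if ab: "a \<in> Q" "b \<in> Q" "g a = g b" for a b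
    proof
      assume less: "?last a < ?last b"
      have "2 \<le> b (?last a)"
        using ab(2) Q_last[OF ab(1)] less order_ideal_counts_ge_2[of b k "?last b" "?last a"]
        by (simp add: Q_def)
      moreover have "g b (?last a) = b (?last a)" using less by (simp add: g_def)
      moreover have "g a (?last a) \<le> 1" by (simp add: g_def)
      ultimately show False using ab(3) by simp
    qed
    fix a b assume ab: "a \<in> Q" "b \<in> Q" "g a = g b"
    then have eq: "?last a = ?last b" using not_less[of a b] not_less[of b a] by simp
    have mem: "a \<in> order_ideal_counts k" "b \<in> order_ideal_counts k"
      using ab by (auto simp: Q_def)
    have below: "a t = b t" if "t < ?last a" for t
      using fun_cong[OF ab(3), of t] that eq by (simp add: g_def)
    \<comment> \<open>The last entry is recovered as what remains of the multiplicity
      \<open>k\<close>.\<close>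
    then have "(\<Sum>t<?last a. a t) = (\<Sum>t<?last b. b t)"
      using eq by (intro sum.cong) auto
    then have "a (?last a) = b (?last a)" using last(3)[OF mem(1)] last(3)[OF mem(2)] eq by simp
    moreover have "a t = 0" "b t = 0" if "?last a < t" for t
      using that eq order_ideal_counts_support(1)[OF mem(1), of t]
        order_ideal_counts_support(1)[OF mem(2), of t] by auto
    ultimately show "a = b"
      using below by (metis ext linorder_neqE_nat)
  qed
  ultimately have "card Q \<le> card (order_ideal_counts (k - 2))"
    by (intro card_inj_on_le[of g] finite_order_ideal_counts) auto
  then show ?thesis
    using P card_Un_le[of P Q] \<open>order_ideal_counts k = P \<union> Q\<close> by simp
qed

text \<open>For these multiplicities a sequence can only consist of \<open>d\<close> ones. Existence
  comes from the order ideal \<open>{0}\<close> for multiplicity 1 and passes to 2 by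
  monotonicity.\<close>

lemma card_order_ideal_counts_1_2:
  "card (order_ideal_counts 1) = 1" "card (order_ideal_counts 2) = 1"
proof -
  have le: "order_ideal_counts d \<subseteq> {\<lambda>t. if t < d then 1 else 0}" if "d = 1 \<or> d = 2" for d
  proof
    fix a assume a: "a \<in> order_ideal_counts d"
    note supp = order_ideal_counts_support[OF a]
    have a0: "a 0 = 1" using order_ideal_counts_0[OF a] that by auto
    have "count_length a \<le> 2" using count_length_le[OF a] that by auto
    then consider "count_length a = 0" | "count_length a = 1" | "count_length a = 2" by linarith
    then have "a t = (if t < d then 1 else 0)" for t
    proof cases
      case 2
      then show ?thesis using supp a0 by (cases t) auto
    next
      case 3
      then have "a 0 + a 1 = d" using supp(2) by (simp add: numeral_2_eq_2)
      moreover have "a 1 \<noteq> 0" using supp(1) 3 by simp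
      ultimately have "d = 2" "a 1 = 1" using that a0 by auto
      then show ?thesis using supp(1)[of t] 3 a0 by (cases t; cases "t - 1") auto
    qed (use supp(1)[of 0] a0 in simp)
    then show "a \<in> {\<lambda>t. if t < d then 1 else 0}" by auto
  qed
  have "order_ideal {0}"
    by (auto simp: order_ideal_def dest: arg_cong[of _ _ monom_degree])
  then have "degree_count {0} \<in> order_ideal_counts 1"
    by (intro order_ideal_countsI[of "{0}"]) auto
  then have "0 < card (order_ideal_counts 1)"
    using finite_order_ideal_counts by (metis card_gt_0_iff empty_iff)
  moreover have "card (order_ideal_counts 1) \<le> card (order_ideal_counts 2)"
    using card_order_ideal_counts_le_Suc[of 1] by (simp add: numeral_2_eq_2)
  moreover have "card (order_ideal_counts d) \<le> 1" if "d = 1 \<or> d = 2" for d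
    using card_mono[OF _ le[OF that]] by simp
  ultimately show "card (order_ideal_counts 1) = 1" "card (order_ideal_counts 2) = 1"
    by (simp_all add: le_antisym)
qed

theorem corollary2p4:
  "sub_Fibonacci (\<lambda>d. int (num_O_sequences TYPE('k::field) d))"
proof -
  have eq: "num_O_sequences TYPE('k) d = card (order_ideal_counts d)" for d
    by (simp add: num_O_sequences_def finite_O_sequences_eq_order_ideal_counts)
  have "card (order_ideal_counts i) \<le> card (order_ideal_counts j)" if "1 \<le> i" "i \<le> j" for i j
    using that(2)
  proof (induction rule: dec_induct)
    case (step n)
    then show ?case using card_order_ideal_counts_le_Suc[of n] that(1) by simp
  qed simp
  then have "mono_on {1..} (\<lambda>d. int (card (order_ideal_counts d)))"
    by (auto intro: mono_onI)
  then show ?thesis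
    unfolding sub_Fibonacci_def eq
    using card_order_ideal_counts_1_2 card_order_ideal_counts_le_add
    by (simp flip: of_nat_add)
qed

end
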